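(* Let $S=\{s_k\}_{k\in\mathbb{N}}$ be the sequence $s_k=-B_k/k$, where $B_k$ are the Bernoulli numbers with $B_1=-1/2$. Let $m\in\mathbb{N}$. Then for each $q\in\{1,\dots,m\}$ one has $$\sum_{k=1}^{q-1}\frac{(-1)^{m-k}}{k!}\Bigg[\prod_{\ell=1}^k(\ell-q)\Bigg]p_{m-k,S}(q-m)=\begin{cases}2p_{m,S}(q-m),&m\text{ odd},\\0,&m\text{ even}.\end{cases}$$
   Context: $\mathbb{N}=\{1,2,\dots\}$, $\mathbb{N}_0=\mathbb{N}\cup\{0\}$; an empty sum is $0$. For a sequence $S=\{s_k\}_{k\in\mathbb{N}}$ and $j\in\mathbb{N}_0$, $$p_{j,S}(t):=\sum_{k=0}^j\frac{(-1)^k}{k!}\widehat{B}_{j,k}(s_1,\dots,s_{j-k+1})\,t^k,$$ where $\widehat{B}_{n,k}$ are the partial ordinary Bell polynomials $$\widehat{B}_{n,k}(z_1,\dots,z_{n-k+1})=\sum\frac{k!}{j_1!j_2!\cdots j_{n-k+1}!}z_1^{j_1}\cdots z_{n-k+1}^{j_{n-k+1}},$$ the sum being over all nonnegative integers $j_1,\dots,j_{n-k+1}$ with $j_1+\cdots+j_{n-k+1}=k$ and $j_1+2j_2+\cdots+(n-k+1)j_{n-k+1}=n$ (so $\widehat B_{0,0}=1$ and $\widehat B_{n,0}=0$ for $n\ge1$). *)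

theory Defs
  imports Complex_Main "HOL-Computational_Algebra.Formal_Power_Series"
begin

text \<open>
  Bernoulli numbers, from the exponential generating function \<open>x / (e^x - 1)\<close>;
  this is the convention with \<open>B_1 = -1/2\<close>.
\<close>

definition bernoulli :: "nat \<Rightarrow> 'a::field_char_0" where
  "bernoulli n = fact n * fps_nth (fps_X / (fps_exp 1 - 1)) n"

lemma bernoulli_egf:
  "(fps_exp 1 - 1) * Abs_fps (\<lambda>n. bernoulli n / fact n) = (fps_X :: 'a::field_char_0 fps)"
proof -
  have eq: "Abs_fps (\<lambda>n. bernoulli n / fact n) = (fps_X / (fps_exp 1 - 1) :: 'a fps)"
    by (simp add: fps_eq_iff bernoulli_def)
  have nth1: "fps_nth (fps_exp 1 - 1 :: 'a fps) 1 \<noteq> 0" by simp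
  then have "subdegree (fps_exp 1 - 1 :: 'a fps) \<le> 1" by (rule subdegree_leI)
  moreover have "(fps_exp 1 - 1 :: 'a fps) \<noteq> 0" using nth1 by (metis fps_zero_nth)
  ultimately have "(fps_exp 1 - 1 :: 'a fps) dvd fps_X" by (simp add: fps_dvd_iff)
  then show ?thesis by (simp add: eq)
qed

lemma bernoulli_0: "bernoulli 0 = (1 :: 'a::field_char_0)"
proof -
  have "fps_nth ((fps_exp 1 - 1) * Abs_fps (\<lambda>n. bernoulli n / fact n)) 1
      = fps_nth (fps_X :: 'a fps) 1" by (simp only: bernoulli_egf)
  then show ?thesis by (simp add: fps_mult_nth)
qed

lemma bernoulli_1: "bernoulli 1 = (- 1 / 2 :: 'a::field_char_0)"
proof -
  have "fps_nth ((fps_exp 1 - 1) * Abs_fps (\<lambda>n. bernoulli n / fact n)) 2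
      = fps_nth (fps_X :: 'a fps) 2" by (simp only: bernoulli_egf)
  then have "bernoulli 1 + 1 / 2 = (0 :: 'a)"
    by (simp add: fps_mult_nth numeral_2_eq_2 bernoulli_0)
  then show ?thesis by (simp add: add_eq_0_iff2)
qed

text \<open>
  The index tuples \<open>(j_1, ..., j_{n-k+1})\<close> are functions vanishing outside
  \<open>{1..n-k+1}\<close>, so that tuples and functions correspond one to one. Sequences
  \<open>(z_i)\<close> start at \<open>i = 1\<close>; the value at 0 is never used. Only \<open>k \<le> n\<close> is
  meaningful; for \<open>k > n\<close> the index set is empty and the value is 0.
\<close>

definition bell_indices :: "nat \<Rightarrow> nat \<Rightarrow> (nat \<Rightarrow> nat) set" where
  "bell_indices n k =
     {j. (\<forall>i. i \<notin> {1..n-k+1} \<longrightarrow> j i = 0) \<and>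
         (\<Sum>i=1..n-k+1. j i) = k \<and> (\<Sum>i=1..n-k+1. i * j i) = n}"

lemma finite_bell_indices: "finite (bell_indices n k)"
proof (rule finite_subset)
  show "bell_indices n k \<subseteq> {j. \<forall>i. (i \<in> {1..n-k+1} \<longrightarrow> j i \<in> {..k}) \<and> (i \<notin> {1..n-k+1} \<longrightarrow> j i = 0)}"
  proof
    fix j assume "j \<in> bell_indices n k"
    then have supp: "\<And>i. i \<notin> {1..n-k+1} \<Longrightarrow> j i = 0" and k: "sum j {1..n-k+1} = k"
      by (auto simp only: bell_indices_def mem_Collect_eq)
    have "j i \<le> sum j {1..n-k+1}" if "i \<in> {1..n-k+1}" for i
      by (rule member_le_sum[OF that]) simp_all
    then have "j i \<in> {..k}" if "i \<in> {1..n-k+1}" for i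
      using that by (simp only: k atMost_iff)
    with supp show "j \<in> {j. \<forall>i. (i \<in> {1..n-k+1} \<longrightarrow> j i \<in> {..k}) \<and> (i \<notin> {1..n-k+1} \<longrightarrow> j i = 0)}"
      by (simp only: mem_Collect_eq) simp
  qed
qed (intro finite_set_of_finite_funs finite_atLeastAtMost finite_atMost)

definition ordinary_bell :: "nat \<Rightarrow> nat \<Rightarrow> (nat \<Rightarrow> 'a::field_char_0) \<Rightarrow> 'a" where
  "ordinary_bell n k z =
     (\<Sum>j\<in>bell_indices n k.
        fact k / (\<Prod>i=1..n-k+1. fact (j i)) * (\<Prod>i=1..n-k+1. z i ^ j i))"

definition bell_poly :: "(nat \<Rightarrow> 'a::field_char_0) \<Rightarrow> nat \<Rightarrow> 'a \<Rightarrow> 'a" where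
  "bell_poly s j t = (\<Sum>k=0..j. (-1) ^ k / fact k * ordinary_bell j k s * t ^ k)"

end

theory Submission
  imports Defs
begin

text \<open>
  Put \<open>S(x) = \<Sum>\<^sub>k s\<^sub>k x\<^sup>k\<close> and \<open>t = q - m\<close>. The polynomials \<open>p\<^sub>j\<close> are the coefficients of
  \<open>F(x) = exp (- t S(x)) = \<Sum>\<^sub>j p\<^sub>j(t) x\<^sup>j\<close> (\<open>bell_poly_eq_exp_nth\<close>), because the partial ordinary
  Bell polynomials are, by the multinomial theorem, the coefficients of the powers \<open>S\<^sup>k\<close>.
  Since \<open>(\<Prod>l=1..k. l - q) / k!\<close> is \<open>(-1)\<^sup>k\<close> times the binomial coefficient of \<open>q - 1\<close> over \<open>k\<close>,
  the left-hand side of the theorem is \<open>(-1)\<^sup>m\<close> times a convolution that lacks only its term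
  \<open>k = 0\<close>, and the claim, for either parity of \<open>m\<close>, becomes
  \<open>[x\<^sup>m] (1 + x)\<^bsup>q-1\<^esup> F(x) = (-1)\<^sup>m [x\<^sup>m] F(x)\<close>.

  This equation comes from the substitution \<open>x \<mapsto> - x / (1 + x)\<close>, called \<open>reflect\<close> below. Two facts
  carry the proof.

  \<^item> For \<open>s\<^sub>k = - B\<^sub>k / k\<close> the substitution changes \<open>S\<close> into \<open>S - log (1 + x)\<close>
    (\<open>bernoulli_log_fps_reflect\<close>). Coefficientwise this is the symmetry
    \<open>B\<^sub>n(1) = (-1)\<^sup>n B\<^sub>n(0)\<close> of the Bernoulli polynomials. Analytically, \<open>S(1/z)\<close> is the asymptotic
    expansion of \<open>\<psi>(z + 1) - log z\<close> for the digamma function \<open>\<psi>\<close>, the substitution is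
    \<open>z \<mapsto> - 1 - z\<close>, and the fact mirrors the reflection formula that relates \<open>\<psi>(z + 1)\<close> to \<open>\<psi>(- z)\<close>.
    Exponentiating, \<open>F = (F \<circ> reflect) (1 + x)\<^bsup>m-q\<^esup>\<close>, where the exponent is a natural number as
    \<open>q \<le> m\<close>.

  \<^item> For every series \<open>G\<close> and \<open>m \<ge> 1\<close>,
    \<open>[x\<^sup>m] G(- x / (1 + x)) (1 + x)\<^bsup>m-1\<^esup> = (-1)\<^sup>m [x\<^sup>m] G(x)\<close> (\<open>reflect_compose_mult_nth\<close>). This is the
    invariance of the residue of \<open>G(y) / y\<^bsup>m+1\<^esup> dy\<close> under the change of variables.

  With \<open>G = F\<close>, the exponents \<open>m - q\<close> and \<open>q - 1\<close> add up to \<open>m - 1\<close>, so the two facts combine.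
\<close>

unbundle fps_syntax

section \<open>Generating functions of Bell polynomials\<close>

definition multiplicities :: "'b set \<Rightarrow> nat \<Rightarrow> ('b \<Rightarrow> nat) set" where
  "multiplicities I k = {j. (\<forall>i. i \<notin> I \<longrightarrow> j i = 0) \<and> sum j I = k}"

lemma finite_multiplicities:
  assumes "finite I"
  shows "finite (multiplicities I k)"
proof (rule finite_subset)
  show "multiplicities I k \<subseteq> {j. \<forall>i. (i \<in> I \<longrightarrow> j i \<in> {..k}) \<and> (i \<notin> I \<longrightarrow> j i = 0)}"
    using assms by (auto simp: multiplicities_def intro: member_le_sum)
qed (intro finite_set_of_finite_funs assms finite_atMost)

text \<open>
  By induction on the index set: the binomial theorem splits off a new index \<open>x\<close>, and a multiplicity
  function on \<open>insert x I\<close> corresponds to the multiplicity \<open>r\<close> of \<open>x\<close> together with its restriction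
  to \<open>I\<close>, which has total \<open>k - r\<close>.
\<close>

lemma multinomial_theorem_fps:
  fixes f :: "'b \<Rightarrow> 'a::field_char_0 fps"
  assumes "finite I"
  shows "sum f I ^ k =
    (\<Sum>j\<in>multiplicities I k. fps_const (fact k / (\<Prod>i\<in>I. fact (j i))) * (\<Prod>i\<in>I. f i ^ j i))"
  using assms
proof (induction I arbitrary: k rule: finite_induct)
  case empty
  have "multiplicities {} k = (if k = 0 then {\<lambda>_::'b. 0} else {})"
    by (auto simp: multiplicities_def)
  then show ?case by (simp add: power_0_left)
next
  case (insert x I)
  define c where "c J k j = fps_const (fact k / (\<Prod>i\<in>J. fact (j i))) * (\<Prod>i\<in>J. f i ^ j i)"
    for J k and j :: "'b \<Rightarrow> nat"
  have "sum f (insert x I) ^ k = (\<Sum>r\<le>k. of_nat (k choose r) * f x ^ r * sum f I ^ (k - r))"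
    using insert.hyps by (simp add: binomial_ring)
  also have "\<dots> = (\<Sum>r\<le>k. \<Sum>j\<in>multiplicities I (k - r). of_nat (k choose r) * f x ^ r * c I (k - r) j)"
    by (simp add: insert.IH c_def sum_distrib_left)
  also have "\<dots> = (\<Sum>(r, j)\<in>(SIGMA r:{..k}. multiplicities I (k - r)).
      of_nat (k choose r) * f x ^ r * c I (k - r) j)"
    by (rule sum.Sigma) (auto simp: finite_multiplicities insert.hyps)
  also have "\<dots> = (\<Sum>j\<in>multiplicities (insert x I) k. c (insert x I) k j)"
  proof (rule sum.reindex_bij_witness[where i = "\<lambda>j. (j x, j(x := 0))" and j = "\<lambda>(r, j). j(x := r)"])
    fix a assume a: "a \<in> (SIGMA r:{..k}. multiplicities I (k - r))"
    obtain r j where rj: "a = (r, j)" by (cases a)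
    have r: "r \<le> k" and supp: "\<And>i. i \<notin> I \<Longrightarrow> j i = 0" and sumj: "sum j I = k - r"
      using a by (auto simp: rj multiplicities_def)
    have upd: "(j(x := r)) i = j i" if "i \<in> I" for i
      using that insert.hyps by auto
    have sum_upd: "(\<Sum>i\<in>I. (j(x := r)) i) = sum j I"
      by (rule sum.cong) (auto simp: upd simp del: fun_upd_apply)
    have "(j(x := r))(x := 0) = j"
      using supp insert.hyps by (auto simp: fun_eq_iff)
    then show "(\<lambda>j. (j x, j(x := 0))) (case a of (r, j) \<Rightarrow> j(x := r)) = a"
      by (simp add: rj)
    show "(case a of (r, j) \<Rightarrow> j(x := r)) \<in> multiplicities (insert x I) k"
      using r supp sumj insert.hyps
      by (simp add: rj multiplicities_def sum_upd del: fun_upd_apply) (auto simp: fun_upd_apply)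
    have "of_nat (k choose r) * (fact (k - r) / (\<Prod>i\<in>I. fact (j i)))
        = (fact k / (fact r * (\<Prod>i\<in>I. fact (j i))) :: 'a)"
      using r by (simp add: binomial_fact)
    then have coeff: "of_nat (k choose r) * fps_const (fact (k - r) / (\<Prod>i\<in>I. fact (j i)))
        = fps_const (fact k / (fact r * (\<Prod>i\<in>I. fact (j i))) :: 'a)"
      by (simp only: fps_of_nat[symmetric] fps_const_mult)
    have "of_nat (k choose r) * f x ^ r * c I (k - r) j
        = (of_nat (k choose r) * fps_const (fact (k - r) / (\<Prod>i\<in>I. fact (j i))))
          * (f x ^ r * (\<Prod>i\<in>I. f i ^ j i))"
      by (simp only: c_def mult_ac)
    also have "\<dots> = fps_const (fact k / (fact r * (\<Prod>i\<in>I. fact (j i)))) * (f x ^ r * (\<Prod>i\<in>I. f i ^ j i))"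
      by (simp only: coeff)
    also have "(\<Prod>i\<in>I. fact (j i)) = (\<Prod>i\<in>I. fact ((j(x := r)) i) :: 'a)"
      by (rule prod.cong) (simp_all only: upd)
    also have "(\<Prod>i\<in>I. f i ^ j i) = (\<Prod>i\<in>I. f i ^ (j(x := r)) i)"
      by (rule prod.cong) (simp_all only: upd)
    also have "fps_const (fact k / (fact r * (\<Prod>i\<in>I. fact ((j(x := r)) i))))
        * (f x ^ r * (\<Prod>i\<in>I. f i ^ (j(x := r)) i)) = c (insert x I) k (j(x := r))"
      using insert.hyps by (simp add: c_def)
    finally show "c (insert x I) k (case a of (r, j) \<Rightarrow> j(x := r))
        = (case a of (r, j) \<Rightarrow> of_nat (k choose r) * f x ^ r * c I (k - r) j)"
      by (simp add: rj)
  next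
    fix j assume j: "j \<in> multiplicities (insert x I) k"
    have upd: "(j(x := 0)) i = j i" if "i \<in> I" for i
      using that insert.hyps by auto
    have sum_upd: "(\<Sum>i\<in>I. (j(x := 0)) i) = sum j I"
      by (rule sum.cong) (auto simp: upd simp del: fun_upd_apply)
    show "(case (j x, j(x := 0)) of (r, j) \<Rightarrow> j(x := r)) = j"
      by simp
    show "(j x, j(x := 0)) \<in> (SIGMA r:{..k}. multiplicities I (k - r))"
      using j insert.hyps
      by (simp add: multiplicities_def sum_upd del: fun_upd_apply) (auto simp: fun_upd_apply)
  qed
  finally show ?case by (simp add: c_def)
qed

lemma fps_power_nth_cong:
  fixes f g :: "'a::comm_ring_1 fps"
  assumes "\<And>i. i \<le> n \<Longrightarrow> f $ i = g $ i" "i \<le> n"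
  shows "f ^ k $ i = g ^ k $ i"
  using assms(2)
proof (induction k arbitrary: i)
  case (Suc k)
  then show ?case by (auto simp: fps_mult_nth assms(1) intro!: sum.cong)
qed simp

text \<open>
  Each of the \<open>k\<close> factors contributes at least degree one, so none of them can contribute more than
  \<open>n - (k - 1)\<close>. This is why \<open>s\<^sub>1, \<dots>, s\<^bsub>n-k+1\<^esub>\<close> are the only arguments of the Bell polynomial
  of index \<open>n, k\<close>. The proof divides both series by \<open>x\<close> and compares coefficients of degree \<open>n - k\<close>.
\<close>

lemma fps_power_nth_cong_0:
  fixes f g :: "'a::field_char_0 fps"
  assumes f0: "f $ 0 = 0" and g0: "g $ 0 = 0"
    and eq: "\<And>i. i \<le> n - k + 1 \<Longrightarrow> f $ i = g $ i" and "k \<le> n"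
  shows "f ^ k $ n = g ^ k $ n"
proof -
  have shift: "h ^ k $ n = fps_shift 1 h ^ k $ (n - k)" if "h $ 0 = 0" for h :: "'a fps"
  proof -
    have "h = fps_X * fps_shift 1 h"
      using that by (intro fps_ext) (auto)
    then have "h ^ k = fps_X ^ k * fps_shift 1 h ^ k"
      by (metis power_mult_distrib)
    then show ?thesis
      using \<open>k \<le> n\<close> by (simp add: fps_X_power_mult_nth)
  qed
  have "fps_shift 1 f ^ k $ (n - k) = fps_shift 1 g ^ k $ (n - k)"
    by (rule fps_power_nth_cong[where n = "n - k"]) (auto simp: eq)
  then show ?thesis by (simp add: shift f0 g0)
qed

text \<open>
  The condition \<open>(\<Sum>i. i * j i) = n\<close> on the index tuples selects, from the multinomial expansion of
  the truncated series, the monomials of degree \<open>n\<close>.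
\<close>

lemma ordinary_bell_eq_fps_power_nth:
  fixes f :: "'a::field_char_0 fps"
  assumes f0: "f $ 0 = 0" and s: "\<And>i. i \<ge> 1 \<Longrightarrow> s i = f $ i" and "k \<le> n"
  shows "ordinary_bell n k s = f ^ k $ n"
proof -
  let ?I = "{1..n - k + 1}"
  define g where "g i = fps_const (s i) * fps_X ^ i" for i
  have monom: "(\<Prod>i\<in>J. g i ^ j i) = fps_const (\<Prod>i\<in>J. s i ^ j i) * fps_X ^ (\<Sum>i\<in>J. i * j i)"
    if "finite J" for J j
    using that
    by (induction J rule: finite_induct)
       (simp_all add: g_def power_mult_distrib power_add mult_ac flip: power_mult fps_const_mult)
  have "f ^ k $ n = sum g ?I ^ k $ n"
  proof (rule fps_power_nth_cong_0)
    show "f $ i = sum g ?I $ i" if "i \<le> n - k + 1" for i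
      using that f0 s[of i] by (cases "i = 0") (auto simp: g_def fps_sum_nth if_distrib
          simp del: sum.cl_ivl_Suc cong: if_cong)
  qed (use f0 \<open>k \<le> n\<close> in \<open>auto simp: g_def fps_sum_nth\<close>)
  also have "\<dots> = (\<Sum>j\<in>multiplicities ?I k. if (\<Sum>i\<in>?I. i * j i) = n
      then fact k / (\<Prod>i\<in>?I. fact (j i)) * (\<Prod>i\<in>?I. s i ^ j i) else 0)"
    unfolding multinomial_theorem_fps[OF finite_atLeastAtMost] fps_sum_nth monom[OF finite_atLeastAtMost]
    by (rule sum.cong) auto
  also have "\<dots> = ordinary_bell n k s"
    unfolding ordinary_bell_def
    by (intro sum.mono_neutral_cong_right finite_multiplicities)
       (auto simp: multiplicities_def bell_indices_def simp del: sum.cl_ivl_Suc)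
  finally show ?thesis ..
qed

lemma bell_poly_eq_exp_nth:
  fixes f :: "'a::field_char_0 fps"
  assumes "f $ 0 = 0" and "\<And>i. i \<ge> 1 \<Longrightarrow> s i = f $ i"
  shows "bell_poly s n t = (fps_exp (- t) oo f) $ n"
  unfolding bell_poly_def fps_compose_nth
  by (rule sum.cong) (simp_all add: ordinary_bell_eq_fps_power_nth[OF assms] power_minus[of t])

section \<open>The substitution of \<open>- x / (1 + x)\<close> for \<open>x\<close>\<close>

lemma one_plus_fps_X_power_nth:
  "((1 + fps_X) ^ n) $ k = (of_nat (n choose k) :: 'a::field_char_0)"
  by (simp add: binomial_gbinomial flip: fps_binomial_of_nat)

definition reflect :: "'a::field_char_0 fps" where
  "reflect = - fps_X * inverse (1 + fps_X)"

lemma reflect_nth_0 [simp]: "reflect $ 0 = 0"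
  by (simp add: reflect_def)

lemma reflect_power: "reflect ^ k =
    (fps_const ((-1) ^ k) * (fps_X ^ k * inverse ((1 + fps_X) ^ k)) :: 'a::field_char_0 fps)"
proof -
  have "reflect = (fps_const (-1) * (fps_X * inverse (1 + fps_X)) :: 'a fps)"
    by (simp add: reflect_def flip: fps_const_neg)
  then show ?thesis
    unfolding \<open>reflect = _\<close> by (simp add: power_mult_distrib fps_inverse_power)
qed

lemma reflect_power_nth:
  assumes "1 \<le> k" "k \<le> n"
  shows "reflect ^ k $ n = (-1) ^ n * (of_nat ((n - 1) choose (k - 1)) :: 'a::field_char_0)"
proof -
  have "reflect ^ k $ n = (-1) ^ k * ((- of_nat k :: 'a) gchoose (n - k))"
    using assms by (simp add: reflect_power fps_X_power_mult_nth flip: fps_binomial_minus_of_nat)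
  also have "(- of_nat k :: 'a) gchoose (n - k) = (-1) ^ (n - k) * (of_nat (n - 1) gchoose (n - k))"
    using assms by (subst gbinomial_minus) (simp add: of_nat_diff algebra_simps)
  also have "(-1) ^ k * ((-1) ^ (n - k) * (of_nat (n - 1) gchoose (n - k)))
      = (-1) ^ n * (of_nat ((n - 1) choose (n - k)) :: 'a)"
    using assms by (simp add: binomial_gbinomial flip: power_add mult.assoc)
  also have "(n - 1) choose (n - k) = (n - 1) choose (k - 1)"
    using assms by (subst binomial_symmetric) auto
  finally show ?thesis .
qed

text \<open>
  By linearity it suffices to take \<open>G = x\<^sup>k\<close>, where the series is
  \<open>(-1)\<^sup>k x\<^sup>k (1 + x)\<^bsup>m-1-k\<^esup>\<close>. For \<open>k < m\<close> this is a polynomial of degree \<open>m - 1\<close>, so it has no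
  coefficient of degree \<open>m\<close>; for \<open>k = m\<close> it starts with \<open>(-1)\<^sup>m x\<^sup>m\<close>; for larger \<open>k\<close> it starts beyond
  degree \<open>m\<close>.
\<close>

lemma reflect_compose_mult_nth:
  fixes G :: "'a::field_char_0 fps"
  assumes "m \<ge> 1"
  shows "((G oo reflect) * (1 + fps_X) ^ (m - 1)) $ m = (-1) ^ m * G $ m"
proof -
  have summand: "(reflect ^ k * (1 + fps_X) ^ (m - 1) :: 'a fps) $ m = (if k = m then (-1) ^ m else 0)"
    if "k \<le> m" for k
  proof (cases "k = m")
    case True
    have "(1 + fps_X :: 'a fps) ^ m = (1 + fps_X) * (1 + fps_X) ^ (m - 1)"
      using assms by (cases m) auto
    then have "(reflect ^ m * (1 + fps_X) ^ (m - 1) :: 'a fps)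
        = fps_const ((-1) ^ m) * (fps_X ^ m * (inverse (1 + fps_X) *
            (inverse ((1 + fps_X) ^ (m - 1)) * (1 + fps_X) ^ (m - 1))))"
      by (simp add: reflect_power fps_inverse_mult mult_ac)
    also have "inverse ((1 + fps_X) ^ (m - 1)) * (1 + fps_X :: 'a fps) ^ (m - 1) = 1"
      by (rule inverse_mult_eq_1) (simp add: fps_power_zeroth)
    finally show ?thesis
      using True by (simp add: fps_X_power_mult_nth)
  next
    case False
    with that have "k < m" by simp
    have "(1 + fps_X :: 'a fps) ^ (m - 1) = (1 + fps_X) ^ k * (1 + fps_X) ^ (m - 1 - k)"
      using \<open>k < m\<close> by (simp flip: power_add)
    then have "(reflect ^ k * (1 + fps_X) ^ (m - 1) :: 'a fps)
        = fps_const ((-1) ^ k) * (fps_X ^ k * (1 + fps_X) ^ (m - 1 - k) *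
            (inverse ((1 + fps_X) ^ k) * (1 + fps_X) ^ k))"
      by (simp add: reflect_power mult_ac)
    also have "inverse ((1 + fps_X) ^ k) * (1 + fps_X :: 'a fps) ^ k = 1"
      by (rule inverse_mult_eq_1) (simp add: fps_power_zeroth)
    finally show ?thesis
      using \<open>k < m\<close> 
      by (simp add: fps_X_power_mult_nth mult.assoc one_plus_fps_X_power_nth binomial_eq_0)
  qed
  \<comment> \<open>A range of summation that does not depend on \<open>i\<close> lets the two sums below be interchanged.\<close>
  have "(G oo reflect) $ i = (\<Sum>k\<le>m. G $ k * reflect ^ k $ i)" if "i \<le> m" for i
    unfolding fps_compose_nth using that
    by (intro sum.mono_neutral_left) (auto simp: startsby_zero_power_prefix)
  then have "((G oo reflect) * (1 + fps_X) ^ (m - 1)) $ m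
      = (\<Sum>i=0..m. \<Sum>k\<le>m. G $ k * (reflect ^ k $ i * (1 + fps_X) ^ (m - 1) $ (m - i)))"
    by (simp add: fps_mult_nth sum_distrib_right mult.assoc)
  also have "\<dots> = (\<Sum>k\<le>m. G $ k * (reflect ^ k * (1 + fps_X) ^ (m - 1)) $ m)"
    by (subst sum.swap) (simp add: fps_mult_nth sum_distrib_left)
  also have "\<dots> = (\<Sum>k\<le>m. if k = m then (-1) ^ m * G $ m else 0)"
    by (intro sum.cong) (auto simp: summand simp del: One_nat_def)
  finally show ?thesis by simp
qed

section \<open>Reflection of the Bernoulli series\<close>

text \<open>
  The left-hand side is the value \<open>B\<^sub>n(1)\<close> of the Bernoulli polynomial. The identity is
  \<open>e\<^sup>x x / (e\<^sup>x - 1) = (- x) / (e\<^bsup>-x\<^esup> - 1)\<close>, read off in the exponential generating functions.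
\<close>

lemma sum_binomial_bernoulli:
  "(\<Sum>k\<le>n. of_nat (n choose k) * bernoulli k) = (-1) ^ n * (bernoulli n :: 'a::field_char_0)"
proof -
  let ?B = "Abs_fps (\<lambda>n. bernoulli n / fact n) :: 'a fps"
  have "(fps_exp (-1) - 1) * (?B oo - fps_X) = - (fps_X :: 'a fps)"
  proof -
    have "(fps_exp 1 - 1) * ?B oo - fps_X = (fps_X :: 'a fps) oo - fps_X"
      by (simp only: bernoulli_egf)
    then show ?thesis
      by (simp add: fps_compose_mult_distrib fps_compose_sub_distrib)
  qed
  moreover have "fps_exp 1 - 1 = - (fps_exp 1 * (fps_exp (-1) - 1 :: 'a fps))"
    by (simp add: algebra_simps flip: fps_exp_add_mult)
  ultimately have "(fps_exp 1 - 1) * (?B oo - fps_X) = fps_exp 1 * fps_X"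
    by (simp add: mult.assoc)
  also have "\<dots> = (fps_exp 1 - 1) * (fps_exp 1 * ?B)"
    by (simp add: bernoulli_egf mult.left_commute)
  finally have eq: "?B oo - fps_X = fps_exp 1 * ?B"
    by (metis fps_exp_eq_1_iff mult_cancel_left one_neq_zero right_minus_eq)
  have "(\<Sum>k\<le>n. of_nat (n choose k) * bernoulli k)
      = fact n * (\<Sum>k=0..n. bernoulli k / fact k * (1 / fact (n - k)) :: 'a)"
    by (simp add: sum_distrib_left atMost_atLeast0 binomial_fact mult_ac)
  also have "(\<Sum>k=0..n. bernoulli k / fact k * (1 / fact (n - k)) :: 'a) = (?B * fps_exp 1) $ n"
    by (simp add: fps_mult_nth)
  also have "?B * fps_exp 1 = ?B oo - fps_X"
    by (simp add: eq mult.commute)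
  finally show ?thesis by (simp add: fps_compose_uminus')
qed

text \<open>
  The asymptotic expansion of \<open>\<psi>(z + 1) - log z\<close> in \<open>x = 1/z\<close>. The constant coefficient is a
  division by zero, which yields the value 0 that is wanted.
\<close>

definition bernoulli_log_fps :: "'a::field_char_0 fps" where
  "bernoulli_log_fps = Abs_fps (\<lambda>k. - bernoulli k / of_nat k)"

lemma bernoulli_log_fps_nth_0 [simp]: "bernoulli_log_fps $ 0 = 0"
  by (simp add: bernoulli_log_fps_def)

text \<open>
  The factor \<open>1/k\<close> in the coefficients turns the binomial coefficient of \<open>n - 1\<close> over \<open>k - 1\<close>, which
  comes from \<open>reflect_power_nth\<close>, into that of \<open>n\<close> over \<open>k\<close>, divided by \<open>n\<close>. The sum is then the one
  in \<open>sum_binomial_bernoulli\<close> except for its term \<open>k = 0\<close>, and this missing term is the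
  logarithm.
\<close>

lemma bernoulli_log_fps_reflect:
  "bernoulli_log_fps oo reflect = bernoulli_log_fps - (fps_ln 1 :: 'a::field_char_0 fps)"
proof (rule fps_ext)
  fix n
  show "(bernoulli_log_fps oo reflect) $ n = (bernoulli_log_fps - fps_ln 1 :: 'a fps) $ n"
  proof (cases "n = 0")
    case False
    have absorb: "- bernoulli k / of_nat k * ((-1) ^ n * of_nat ((n - 1) choose (k - 1)))
        = - ((-1) ^ n / of_nat n) * (of_nat (n choose k) * bernoulli k :: 'a)" if "k \<in> {1..n}" for k
    proof -
      have "k * (n choose k) = n * ((n - 1) choose (k - 1))"
        using that by (simp add: times_binomial_minus1_eq)
      then have "of_nat k * of_nat (n choose k) = (of_nat n * of_nat ((n - 1) choose (k - 1)) :: 'a)"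
        by (metis of_nat_mult)
      then show ?thesis using that False by (simp add: field_simps)
    qed
    have "(bernoulli_log_fps oo reflect) $ n = (\<Sum>k\<in>{1..n}. bernoulli_log_fps $ k * (reflect ^ k $ n :: 'a))"
      unfolding fps_compose_nth by (rule sum.mono_neutral_right) (auto simp: Suc_le_eq)
    also have "\<dots> = (\<Sum>k\<in>{1..n}. - ((-1) ^ n / of_nat n) * (of_nat (n choose k) * bernoulli k))"
    proof (rule sum.cong)
      fix k assume k: "k \<in> {1..n}"
      show "bernoulli_log_fps $ k * reflect ^ k $ n
          = - ((-1) ^ n / of_nat n) * (of_nat (n choose k) * bernoulli k :: 'a)"
        unfolding absorb[OF k, symmetric] using k
        by (simp add: bernoulli_log_fps_def reflect_power_nth)
    qed simp
    also have "\<dots> = - ((-1) ^ n / of_nat n) * ((\<Sum>k\<le>n. of_nat (n choose k) * bernoulli k) - 1)"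
      unfolding sum_distrib_left[symmetric]
      by (simp add: atMost_atLeast0 sum.atLeast_Suc_atMost bernoulli_0)
    also have "\<dots> = - bernoulli n / of_nat n + (-1) ^ n / of_nat n"
      unfolding sum_binomial_bernoulli using False by (simp add: field_simps)
    also have "\<dots> = (bernoulli_log_fps - fps_ln 1) $ n"
      using False by (cases n) (simp_all add: bernoulli_log_fps_def fps_ln_nth)
    finally show ?thesis .
  qed simp
qed

text \<open>
  Exponentiating \<open>S = S \<circ> reflect + log (1 + x)\<close>. Both sides have the logarithmic derivative
  \<open>S'\<close>, so the quotient of the right-hand side by \<open>E\<close> has derivative 0; it is written as
  a product with \<open>D = exp (- S)\<close>.
\<close>

lemma exp_bernoulli_log_fps_reflect:
  defines "E \<equiv> fps_exp 1 oo (bernoulli_log_fps :: 'a::field_char_0 fps)"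
  shows "E = (E oo reflect) * (1 + fps_X)"
proof -
  let ?S = "bernoulli_log_fps :: 'a fps"
  let ?D = "fps_exp (-1) oo ?S"
  have X1: "inverse (1 + fps_X) * (1 + fps_X) = (1 :: 'a fps)"
    by (rule inverse_mult_eq_1) simp
  have ED: "E * ?D = 1"
    by (simp add: E_def flip: fps_compose_mult_distrib fps_exp_add_mult)
  have E': "E oo reflect = fps_exp 1 oo (?S - fps_ln 1)"
    unfolding E_def by (simp add: fps_compose_assoc flip: bernoulli_log_fps_reflect)
  have dE: "fps_deriv (E oo reflect) = (E oo reflect) * (fps_deriv ?S - inverse (1 + fps_X))"
    unfolding E' by (simp add: fps_compose_deriv fps_ln_deriv)
  have dD: "fps_deriv ?D = - ?D * fps_deriv ?S"
    by (simp add: fps_compose_deriv fps_compose_uminus fps_const_neg[symmetric] del: fps_const_neg)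
  have "fps_deriv ((E oo reflect) * (1 + fps_X) * ?D)
      = (E oo reflect) * ?D * (1 - inverse (1 + fps_X) * (1 + fps_X))"
    by (simp add: dE dD algebra_simps)
  then have "fps_deriv ((E oo reflect) * (1 + fps_X) * ?D) = 0"
    unfolding X1 by simp
  then have "(E oo reflect) * (1 + fps_X) * ?D = fps_const (((E oo reflect) * (1 + fps_X) * ?D) $ 0)"
    by (rule fps_deriv_eq_0_iff[THEN iffD1])
  then have one: "(E oo reflect) * (1 + fps_X) * ?D = 1"
    by (simp add: E_def)
  have "E = (E oo reflect) * (1 + fps_X) * ?D * E"
    unfolding one by simp
  also have "\<dots> = (E oo reflect) * (1 + fps_X) * (E * ?D)"
    by (simp only: mult_ac)
  finally show ?thesis
    unfolding ED by simp
qed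

lemma exp_of_nat_bernoulli_log_fps_reflect:
  defines "E \<equiv> \<lambda>n. fps_exp (of_nat n) oo (bernoulli_log_fps :: 'a::field_char_0 fps)"
  shows "E n = (E n oo reflect) * (1 + fps_X) ^ n"
proof -
  have E: "E n = (fps_exp 1 oo bernoulli_log_fps) ^ n"
    by (simp add: E_def fps_compose_power fps_exp_power_mult)
  show ?thesis
    unfolding E fps_compose_power[OF reflect_nth_0, symmetric] power_mult_distrib[symmetric]
    by (simp flip: exp_bernoulli_log_fps_reflect)
qed

section \<open>The convolution identity\<close>

lemma prod_of_nat_minus:
  "(\<Prod>l=1..k. of_nat l - a) = (-1) ^ k * (fact k * ((a - 1) gchoose k :: 'a::field_char_0))"
proof -
  have "(\<Prod>l=1..k. of_nat l - a) = (\<Prod>i<k. (-1) * (a - 1 - of_nat i))"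
    by (simp add: prod.atLeast1_atMost_eq algebra_simps)
  also have "\<dots> = (-1) ^ k * (\<Prod>i<k. a - 1 - of_nat i)"
    unfolding prod.distrib by simp
  finally show ?thesis
    by (simp add: gbinomial_mult_fact atLeast0LessThan)
qed

theorem proposition2p6:
  fixes s :: "nat \<Rightarrow> real" and m :: nat
  assumes s: "\<And>k. k \<ge> 1 \<Longrightarrow> s k = - bernoulli k / real k"
    and m: "m \<ge> 1"
  shows "\<forall>q\<in>{1..m}.
    (\<Sum>k=1..q-1. (-1) ^ (m - k) / fact k * (\<Prod>l=1..k. real l - real q)
        * bell_poly s (m - k) (real q - real m))
    = (if odd m then 2 * bell_poly s m (real q - real m) else 0)"
proof
  fix q assume q: "q \<in> {1..m}"
  define p where "p j = bell_poly s j (real q - real m)" for j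
  \<comment> \<open>Here \<open>- t = m - q\<close>.\<close>
  define F :: "real fps" where "F = fps_exp (of_nat (m - q)) oo bernoulli_log_fps"
  have p: "p j = F $ j" for j
    using q s unfolding p_def F_def
    by (subst bell_poly_eq_exp_nth[where f = bernoulli_log_fps])
       (auto simp: bernoulli_log_fps_def of_nat_diff)
  have summand: "(-1) ^ (m - k) / fact k * (\<Prod>l=1..k. real l - real q) * p (m - k)
      = (-1) ^ m * (((1 + fps_X) ^ (q - 1)) $ k * F $ (m - k))" if "k \<in> {1..q-1}" for k
  proof -
    have "m - k + k = m" using that q by auto
    then have "(-1 :: real) ^ (m - k) * (-1) ^ k = (-1) ^ m"
      by (simp flip: power_add)
    moreover have "((1 + fps_X) ^ (q - 1) :: real fps) $ k = (real q - 1) gchoose k"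
      using q by (simp add: one_plus_fps_X_power_nth binomial_gbinomial of_nat_diff)
    ultimately show ?thesis
      unfolding prod_of_nat_minus p by (simp add: mult_ac)
  qed
  \<comment> \<open>The exponent \<open>m - q\<close> comes from the reflection of \<open>F\<close>; the sum of the exponents is the one
    at which the coefficient of degree \<open>m\<close> is invariant under the substitution.\<close>
  have "F * (1 + fps_X) ^ (q - 1) = (F oo reflect) * (1 + fps_X) ^ ((m - q) + (q - 1))"
    unfolding F_def power_add mult.assoc[symmetric]
    by (simp flip: exp_of_nat_bernoulli_log_fps_reflect)
  also have "(m - q) + (q - 1) = m - 1" using q by auto
  finally have "((1 + fps_X) ^ (q - 1) * F) $ m = (-1) ^ m * F $ m"
    by (simp add: mult.commute[of _ F] reflect_compose_mult_nth[OF m] del: One_nat_def)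
  also have "((1 + fps_X) ^ (q - 1) * F) $ m
      = (\<Sum>k=0..q-1. ((1 + fps_X) ^ (q - 1)) $ k * F $ (m - k))"
    unfolding fps_mult_nth using q
    by (intro sum.mono_neutral_right)
       (auto simp: one_plus_fps_X_power_nth binomial_eq_0)
  also have "\<dots> = F $ m + (\<Sum>k=1..q-1. ((1 + fps_X) ^ (q - 1)) $ k * F $ (m - k))"
    by (simp add: sum.atLeast_Suc_atMost fps_power_zeroth)
  finally have "(\<Sum>k=1..q-1. ((1 + fps_X) ^ (q - 1)) $ k * F $ (m - k)) = (-1) ^ m * F $ m - F $ m"
    by simp
  then have "(\<Sum>k=1..q-1. (-1) ^ (m - k) / fact k * (\<Prod>l=1..k. real l - real q) * p (m - k))
      = (-1) ^ m * ((-1) ^ m * F $ m - F $ m)"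
    by (simp only: summand sum_distrib_left[symmetric] cong: sum.cong)
  then show "(\<Sum>k=1..q-1. (-1) ^ (m - k) / fact k * (\<Prod>l=1..k. real l - real q)
        * bell_poly s (m - k) (real q - real m))
    = (if odd m then 2 * bell_poly s m (real q - real m) else 0)"
    by (auto simp: p_def[symmetric] p)
qed

end
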